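(* For the windmill graph $Wd(r,s)$ and a vertex $a'$ of $Wd(r,s)$, $$d_d(a')=\begin{cases}1 & \text{if } a' \text{ is the center vertex},\\ s & \text{otherwise.}\end{cases}$$
   Context: A dominating set of a finite simple graph $G$ is a set $D\subseteq V(G)$ such that every vertex in $V(G)\setminus D$ is adjacent to some vertex of $D$. A minimal dominating set is a dominating set that does not properly contain any other dominating set. The domination degree of a vertex $a$ is $d_d(a)=\min\{|D| : D \text{ is a minimal dominating set of } G \text{ with } a\in D\}$. For positive integers $r,s$, the windmill graph $Wd(r,s)$ is obtained by taking $s$ copies of the complete graph $K_r$ sharing one common vertex; this common vertex is the center vertex. *)

theory Defs
  imports "Graph_Theory.Graph_Theory"
begin

text \<open>
  Finite simple graphs are the symmetric loop-free digraphs without parallel arcs of the locale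
  \<^locale>\<open>graph\<close>; every edge is a pair of opposite arcs.
\<close>

definition dominating_set :: "('a, 'b) pre_digraph \<Rightarrow> 'a set \<Rightarrow> bool" where
  "dominating_set G D \<longleftrightarrow>
     D \<subseteq> verts G \<and> (\<forall>v \<in> verts G - D. \<exists>u \<in> D. v \<rightarrow>\<^bsub>G\<^esub> u)"

definition minimal_dominating_set :: "('a, 'b) pre_digraph \<Rightarrow> 'a set \<Rightarrow> bool" where
  "minimal_dominating_set G D \<longleftrightarrow>
     dominating_set G D \<and> \<not> (\<exists>D'. D' \<subset> D \<and> dominating_set G D')"

definition domination_degree :: "('a, 'b) pre_digraph \<Rightarrow> 'a \<Rightarrow> nat" where
  "domination_degree G a = Min {card D |D. minimal_dominating_set G D \<and> a \<in> D}"

text \<open>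
  The set in \<^const>\<open>domination_degree\<close> is finite and nonempty, so that its minimum is attained:
  a maximal independent set containing the given vertex is a minimal dominating set.
\<close>

lemma (in graph) ex_minimal_dominating_set:
  assumes "a \<in> verts G"
  shows "\<exists>D. minimal_dominating_set G D \<and> a \<in> D"
proof -
  define I where "I = {D. D \<subseteq> verts G \<and> a \<in> D \<and> (\<forall>u\<in>D. \<forall>v\<in>D. \<not> u \<rightarrow>\<^bsub>G\<^esub> v)}"
  have "finite I" unfolding I_def by (rule finite_subset[of _ "Pow (verts G)"]) auto
  moreover have "{a} \<in> I" using assms adj_not_same by (auto simp: I_def)
  ultimately obtain D where D: "D \<in> I" and mx: "\<And>E. E \<in> I \<Longrightarrow> D \<subseteq> E \<Longrightarrow> E = D"
    by (metis finite_has_maximal2)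
  have "\<exists>u\<in>D. v \<rightarrow>\<^bsub>G\<^esub> u" if v: "v \<in> verts G - D" for v
  proof (rule ccontr)
    assume n: "\<not> (\<exists>u\<in>D. v \<rightarrow>\<^bsub>G\<^esub> u)"
    have "\<not> u \<rightarrow>\<^bsub>G\<^esub> v" if "u \<in> D" for u
      using n that arcs_ends_symmetric[OF sym_arcs] by blast
    then have "insert v D \<in> I"
      using D v n adj_not_same[of v] unfolding I_def by auto
    then show False using mx[of "insert v D"] v by auto
  qed
  then have dom: "dominating_set G D" using D by (auto simp: dominating_set_def I_def)
  have "\<not> dominating_set G E" if E: "E \<subset> D" for E
  proof
    assume dE: "dominating_set G E"
    obtain x where x: "x \<in> D" "x \<notin> E" using E by auto
    then have "x \<in> verts G - E" using D by (auto simp: I_def)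
    then obtain u where "u \<in> E" "x \<rightarrow>\<^bsub>G\<^esub> u" using dE by (auto simp: dominating_set_def)
    then show False using x D E by (auto simp: I_def)
  qed
  then show ?thesis using dom D by (auto simp: minimal_dominating_set_def I_def)
qed

lemma (in graph) finite_domination_cards:
  "finite {card D |D. minimal_dominating_set G D \<and> a \<in> D}"
proof -
  have "{card D |D. minimal_dominating_set G D \<and> a \<in> D} \<subseteq> card ` Pow (verts G)"
    by (auto simp: minimal_dominating_set_def dominating_set_def)
  then show ?thesis by (rule finite_subset) auto
qed

text \<open>
  Like \<^const>\<open>complete_digraph\<close>, the windmill graph is specified up to isomorphism:
  \<open>windmill_graph r s c G\<close> says that \<open>G\<close> is the union of \<open>s\<close> copies \<open>B i\<close> of the complete graph
  on \<open>r\<close> vertices which pairwise share exactly the vertex \<open>c\<close>, the center.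
  For \<open>s = 1\<close> any vertex can serve as center.
\<close>

definition windmill_graph :: "nat \<Rightarrow> nat \<Rightarrow> 'a \<Rightarrow> ('a, 'b) pre_digraph \<Rightarrow> bool" where
  "windmill_graph r s c G \<longleftrightarrow>
     graph G \<and>
     (\<exists>B :: nat \<Rightarrow> ('a, 'b) pre_digraph.
        (\<forall>i<s. K\<^bsub>r\<^esub> (B i) \<and> subgraph (B i) G \<and> c \<in> verts (B i)) \<and>
        (\<forall>i<s. \<forall>j<s. i \<noteq> j \<longrightarrow> verts (B i) \<inter> verts (B j) = {c}) \<and>
        verts G = (\<Union>i<s. verts (B i)) \<and>
        arcs G = (\<Union>i<s. arcs (B i)))"

lemma ex_windmill_graph:
  assumes "r \<ge> 1" "s \<ge> 1"
  shows "\<exists>G :: (nat \<times> nat, (nat \<times> nat) \<times> (nat \<times> nat)) pre_digraph. windmill_graph r s (0, 0) G"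
proof -
  define V where "V i = insert (0, 0) ({i} \<times> {1..<r})" for i :: nat
  define A where "A i = {(u, v). (u, v) \<in> V i \<times> V i \<and> u \<noteq> v}" for i
  define B where "B i = \<lparr>pverts = V i, parcs = A i\<rparr>" for i
  define G where "G = \<lparr>pverts = (\<Union>i<s. V i), parcs = (\<Union>i<s. A i)\<rparr>"
  have finV: "finite (V i)" and cardV: "card (V i) = r" for i
    using assms by (auto simp: V_def card_insert_if)
  have finA: "finite (A i)" for i
    by (rule finite_subset[of _ "V i \<times> V i"]) (auto simp: A_def finV)
  have K: "K\<^bsub>r\<^esub> (with_proj (B i))" for i
    unfolding complete_digraph_pair_def by (auto simp: B_def A_def finV cardV)
  have "finite (parcs G)" using finA by (simp add: G_def)
  then have "pair_graph G"
    by unfold_locales (auto simp: G_def A_def finV symmetric_def intro!: symI)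
  then interpret pair_graph G .
  have gr: "graph (with_proj G)" by unfold_locales
  have sub: "subgraph (with_proj (B i)) (with_proj G)" if "i < s" for i
  proof -
    have "wf_digraph (with_proj (B i))" by unfold_locales (auto simp: B_def A_def)
    moreover have "wf_digraph (with_proj G)" by unfold_locales
    ultimately show ?thesis using that
      by (auto simp: subgraph_def compatible_def B_def G_def)
  qed
  show ?thesis unfolding windmill_graph_def
  proof (intro exI[of _ "with_proj G"] conjI exI[of _ "\<lambda>i. with_proj (B i)"] gr allI impI)
  qed (use K sub in \<open>auto simp: B_def G_def V_def\<close>)
qed

end

theory Submission
  imports Defs
begin

text \<open>
  The center \<open>c\<close> is adjacent to every other vertex, so \<open>{c}\<close> is a minimal dominating set, and no
  other minimal dominating set contains \<open>c\<close>. This settles the center, and it shows that a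
  minimal dominating set \<open>D\<close> through another vertex avoids \<open>c\<close>. All neighbours of a vertex other
  than the center lie in its own copy of the complete graph, so the copies can then only be
  dominated independently of each other: \<open>D\<close> meets every copy
  (\<open>dominating_set_meets_blade\<close>), and by minimality it meets none twice
  (\<open>minimal_dominating_set_blade_unique\<close>). Off the center the copies are disjoint, so every such
  \<open>D\<close> has exactly \<open>s\<close> elements. The minimum is therefore taken over a single value, and
  \<open>ex_minimal_dominating_set\<close> guarantees that it is taken over a nonempty set.
\<close>

text \<open>
  Domination depends on the vertex sets of the copies only: adjacency in the windmill graph means
  being distinct and lying in a common copy. Eliminating the copies as digraphs in favour of their
  vertex sets \<open>V i\<close> removes arcs from all later arguments.
\<close>

lemma windmill_graph_blades:
  assumes "windmill_graph r s c G"
  obtains V where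
    "\<And>i. i < s \<Longrightarrow> card (V i) = r"
    "\<And>i. i < s \<Longrightarrow> c \<in> V i"
    "\<And>i j. i < s \<Longrightarrow> j < s \<Longrightarrow> i \<noteq> j \<Longrightarrow> V i \<inter> V j = {c}"
    "verts G = (\<Union>i<s. V i)"
    "\<And>u v. u \<rightarrow>\<^bsub>G\<^esub> v \<longleftrightarrow> u \<noteq> v \<and> (\<exists>i<s. u \<in> V i \<and> v \<in> V i)"
proof -
  from assms obtain B :: "nat \<Rightarrow> ('a, 'b) pre_digraph" where
    B: "\<forall>i<s. K\<^bsub>r\<^esub> (B i) \<and> subgraph (B i) G \<and> c \<in> verts (B i)"
    and dis: "\<forall>i<s. \<forall>j<s. i \<noteq> j \<longrightarrow> verts (B i) \<inter> verts (B j) = {c}"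
    and vG: "verts G = (\<Union>i<s. verts (B i))" and aG: "arcs G = (\<Union>i<s. arcs (B i))"
    unfolding windmill_graph_def by (elim conjE exE)
  have ends: "arc_to_ends G = arc_to_ends (B i)" if "i < s" for i
    using B that by (simp add: subgraph_def compatible_def arc_to_ends_def fun_eq_iff)
  have "arcs_ends G = (\<Union>i<s. arcs_ends (B i))"
    unfolding arcs_ends_def aG image_UN by (intro SUP_cong image_cong refl) (simp add: ends)
  also have "\<dots> = (\<Union>i<s. {(u, v). u \<in> verts (B i) \<and> v \<in> verts (B i) \<and> u \<noteq> v})"
    using B by (intro SUP_cong refl) (auto simp: complete_digraph_def)
  finally have adj: "u \<rightarrow>\<^bsub>G\<^esub> v \<longleftrightarrow> u \<noteq> v \<and> (\<exists>i<s. u \<in> verts (B i) \<and> v \<in> verts (B i))"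
    for u v
    by auto
  show thesis
  proof (rule that[of "\<lambda>i. verts (B i)"])
    show "card (verts (B i)) = r" if "i < s" for i
      using B that by (simp add: complete_digraph_def)
  qed (use B dis vG adj in blast)+
qed

lemma minimal_dominating_set_center:
  assumes "windmill_graph r s c G" "s \<ge> 1"
  shows "minimal_dominating_set G {c}"
proof -
  obtain V where "\<And>i. i < s \<Longrightarrow> card (V i) = r"
    and V: "\<And>i. i < s \<Longrightarrow> c \<in> V i"
    and "\<And>i j. i < s \<Longrightarrow> j < s \<Longrightarrow> i \<noteq> j \<Longrightarrow> V i \<inter> V j = {c}"
    and V': "verts G = (\<Union>i<s. V i)"
    "\<And>u v. u \<rightarrow>\<^bsub>G\<^esub> v \<longleftrightarrow> u \<noteq> v \<and> (\<exists>i<s. u \<in> V i \<and> v \<in> V i)"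
    by (fact windmill_graph_blades[OF assms(1)])
  have "c \<in> V 0" using V assms(2) by simp
  then have c: "c \<in> verts G" using V'(1) assms(2) by force
  then have "dominating_set G {c}"
    using V V' by (auto simp: dominating_set_def)
  moreover have "\<not> dominating_set G {}"
    using c by (auto simp: dominating_set_def)
  ultimately show ?thesis
    by (auto simp: minimal_dominating_set_def psubset_eq subset_singleton_iff)
qed

text \<open>
  The copy \<open>V i\<close> has at least two vertices, hence one other than the center, and only vertices of
  \<open>V i\<close> can dominate that one.
\<close>

lemma dominating_set_meets_blade:
  assumes "dominating_set G D" and i: "i < s" and "2 \<le> card (V i)"
    and dis: "\<And>i j. i < s \<Longrightarrow> j < s \<Longrightarrow> i \<noteq> j \<Longrightarrow> V i \<inter> V j = {c}"
    and vG: "verts G = (\<Union>i<s. V i)"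
    and adj: "\<And>u v. u \<rightarrow>\<^bsub>G\<^esub> v \<longleftrightarrow> u \<noteq> v \<and> (\<exists>i<s. u \<in> V i \<and> v \<in> V i)"
  shows "\<exists>u \<in> D. u \<in> V i"
proof -
  have "\<not> V i \<subseteq> {c}"
    using assms(3) card_mono[of "{c}" "V i"] by auto
  then obtain x where x: "x \<in> V i" "x \<noteq> c" by auto
  show ?thesis
  proof (cases "x \<in> D")
    case False
    then obtain u where "u \<in> D" "x \<rightarrow>\<^bsub>G\<^esub> u"
      using assms(1) x i vG unfolding dominating_set_def by blast
    moreover from this obtain j where "j < s" "x \<in> V j" "u \<in> V j"
      using adj by blast
    ultimately show ?thesis
      using dis[OF i, of j] x by (cases "j = i") auto
  qed (use x in auto)
qed

text \<open>
  Two vertices of one copy, neither of them the center, have the same closed neighbourhood, namely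
  that copy. One of the two is therefore redundant in any dominating set.
\<close>

lemma minimal_dominating_set_blade_unique:
  assumes D: "minimal_dominating_set G D" "c \<notin> D" and i: "i < s"
    and x: "x \<in> D" "x \<in> V i" and y: "y \<in> D" "y \<in> V i"
    and dis: "\<And>i j. i < s \<Longrightarrow> j < s \<Longrightarrow> i \<noteq> j \<Longrightarrow> V i \<inter> V j = {c}"
    and adj: "\<And>u v. u \<rightarrow>\<^bsub>G\<^esub> v \<longleftrightarrow> u \<noteq> v \<and> (\<exists>i<s. u \<in> V i \<and> v \<in> V i)"
  shows "x = y"
proof (rule ccontr)
  assume "x \<noteq> y"
  have dom: "dominating_set G D" using D by (simp add: minimal_dominating_set_def)
  have "\<exists>u \<in> D - {y}. v \<rightarrow>\<^bsub>G\<^esub> u" if v: "v \<in> verts G - (D - {y})" for v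
  proof (cases "v \<in> V i")
    case True
    then have "v \<rightarrow>\<^bsub>G\<^esub> x" using v x i \<open>x \<noteq> y\<close> adj by auto
    then show ?thesis using x \<open>x \<noteq> y\<close> by auto
  next
    case False
    then obtain u where u: "u \<in> D" "v \<rightarrow>\<^bsub>G\<^esub> u"
      using dom v y unfolding dominating_set_def by blast
    then obtain j where j: "j < s" "v \<in> V j" "u \<in> V j" using adj by blast
    have "u \<noteq> y"
    proof
      assume "u = y"
      moreover have "V i \<inter> V j = {c}" using dis[OF i j(1)] False j(2) by blast
      ultimately show False using j(3) y D(2) by auto
    qed
    then show ?thesis using u by auto
  qed
  then have "dominating_set G (D - {y})"
    using dom by (auto simp: dominating_set_def)
  then show False using D y by (auto simp: minimal_dominating_set_def)
qed

lemma card_minimal_dominating_set_avoiding_center: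
  assumes "windmill_graph r s c G" "r \<ge> 2"
    and D: "minimal_dominating_set G D" "c \<notin> D"
  shows "card D = s"
proof -
  obtain V where V: "\<And>i. i < s \<Longrightarrow> card (V i) = r"
    and "\<And>i. i < s \<Longrightarrow> c \<in> V i"
    and dis: "\<And>i j. i < s \<Longrightarrow> j < s \<Longrightarrow> i \<noteq> j \<Longrightarrow> V i \<inter> V j = {c}"
    and vG: "verts G = (\<Union>i<s. V i)"
    and adj: "\<And>u v. u \<rightarrow>\<^bsub>G\<^esub> v \<longleftrightarrow> u \<noteq> v \<and> (\<exists>i<s. u \<in> V i \<and> v \<in> V i)"
    by (fact windmill_graph_blades[OF assms(1)])
  have dom: "dominating_set G D" using D by (simp add: minimal_dominating_set_def)
  have one: "\<exists>x. D \<inter> V i = {x}" if i: "i < s" for i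
  proof -
    obtain x where x: "x \<in> D" "x \<in> V i"
      using dominating_set_meets_blade[where V = V, OF dom i _ dis vG adj] V[OF i] assms(2) by auto
    have "y = x" if "y \<in> D" "y \<in> V i" for y
      using minimal_dominating_set_blade_unique[where V = V, OF D i that x dis adj] .
    then show ?thesis using x by blast
  qed
  have "D = (\<Union>i<s. D \<inter> V i)"
    using dom vG by (auto simp: dominating_set_def)
  also have "card \<dots> = (\<Sum>i<s. card (D \<inter> V i))"
  proof (rule card_UN_disjoint)
    show "\<forall>i\<in>{..<s}. finite (D \<inter> V i)"
      using one by (metis finite.emptyI finite.insertI lessThan_iff)
    show "\<forall>i\<in>{..<s}. \<forall>j\<in>{..<s}. i \<noteq> j \<longrightarrow> (D \<inter> V i) \<inter> (D \<inter> V j) = {}"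
    proof (intro ballI impI)
      fix i j assume "i \<in> {..<s}" "j \<in> {..<s}" "i \<noteq> j"
      then have "V i \<inter> V j = {c}" by (intro dis) auto
      then show "(D \<inter> V i) \<inter> (D \<inter> V j) = {}" using D(2) by auto
    qed
  qed simp
  also have "\<dots> = (\<Sum>i<s. 1)"
    by (rule sum.cong) (use one in fastforce)+
  finally show ?thesis by simp
qed

theorem theorem3p19:
  fixes G :: "('a, 'b) pre_digraph" and c a' :: 'a and r s :: nat
  assumes "r \<ge> 1" and "s \<ge> 1"
    and "windmill_graph r s c G"
    and "a' \<in> verts G"
  shows "domination_degree G a' = (if a' = c then 1 else s)"
proof -
  interpret graph G using assms(3) by (simp add: windmill_graph_def)
  note center = minimal_dominating_set_center[OF assms(3,2)]
  have only_center: "D = {c}" if "minimal_dominating_set G D" "c \<in> D" for D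
    using that center unfolding minimal_dominating_set_def by blast
  obtain D\<^sub>0 where D\<^sub>0: "minimal_dominating_set G D\<^sub>0" "a' \<in> D\<^sub>0"
    using ex_minimal_dominating_set[OF assms(4)] by blast
  have card_eq: "card D = (if a' = c then 1 else s)" if D: "minimal_dominating_set G D" "a' \<in> D" for D
  proof (cases "a' = c")
    case True
    then have "D = {c}" using only_center D by blast
    then show ?thesis using True by simp
  next
    case False
    obtain V where V: "\<And>i. i < s \<Longrightarrow> card (V i) = r" "\<And>i. i < s \<Longrightarrow> c \<in> V i"
      and "\<And>i j. i < s \<Longrightarrow> j < s \<Longrightarrow> i \<noteq> j \<Longrightarrow> V i \<inter> V j = {c}"
      and vG: "verts G = (\<Union>i<s. V i)"
      and "\<And>u v. u \<rightarrow>\<^bsub>G\<^esub> v \<longleftrightarrow> u \<noteq> v \<and> (\<exists>i<s. u \<in> V i \<and> v \<in> V i)"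
      by (fact windmill_graph_blades[OF assms(3)])
    obtain i where i: "i < s" "a' \<in> V i" using assms(4) vG by auto
    \<comment> \<open>A copy with a vertex besides the center has at least two vertices.\<close>
    have "finite (V i)" using V(1)[OF i(1)] assms(1) card_ge_0_finite by force
    then have "card {a', c} \<le> card (V i)" using i V(2) by (intro card_mono) auto
    then have "r \<ge> 2" using V(1)[OF i(1)] False by simp
    moreover have "c \<notin> D" using only_center[OF D(1)] D(2) False by auto
    ultimately show ?thesis
      using card_minimal_dominating_set_avoiding_center[OF assms(3) _ D(1)] False by simp
  qed
  have "{card D |D. minimal_dominating_set G D \<and> a' \<in> D} = {if a' = c then 1 else s}"
    (is "?S = {?k}")
  proof (intro equalityI subsetI)
    show "n \<in> ?S" if "n \<in> {?k}" for n
      using that D\<^sub>0 card_eq[OF D\<^sub>0] by force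
  qed (use card_eq in auto)
  then show ?thesis unfolding domination_degree_def by simp
qed

end
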